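(* Let $s\ge 1$ and $q$ be integers with $0\le q\le s$, and let $n=T_s+q$. For every $(a,b)\in\Pi_n$, conjugation of partitions $\lambda\mapsto\lambda'$ induces a bijection $$M_n^{(a,b)}\longrightarrow M_n^{(b,a)}.$$ In particular, $|M_n^{(a,b)}|=|M_n^{(b,a)}|$ for every $(a,b)\in\Pi_n$.
   Context: For an integer $m\ge 0$, $T_m:=m(m+1)/2$. Compressed form: a partition $\lambda$ is written $\lambda=(L_1^{m_1},\dots,L_r^{m_r})$ with $L_1>\cdots>L_r>0$ its distinct part sizes and $m_i\ge 1$ the multiplicity of $L_i$. Gaps: $g_i=L_i-L_{i+1}$ for $1\le i<r$ and $g_r=L_r$. Set $A(\lambda):=\#\{i:g_i>1\}$ and $B(\lambda):=\#\{i:m_i>1\}$. The conjugate $\lambda'$ is the partition whose Ferrers diagram is the transpose of that of $\lambda$. Partition graph: for $n\ge 1$, $G_n$ is the simple graph whose vertices are the integer partitions of $n$; two distinct partitions are adjacent if one is obtained from the other by an elementary transfer of one unit from one part to another (subtract $1$ from one part and add $1$ to another part), followed by reordering. Here the receiving part may be a zero part (so a new part $1$ may be created), and parts that become $0$ are discarded. $\deg(\lambda)$ is the degree of $\lambda$ in $G_n$, $\Delta_n:=\max_{\lambda\vdash n}\deg(\lambda)$, $M_n:=\{\lambda\vdash n:\deg(\lambda)=\Delta_n\}$, $\Pi_n:=\{(A(\lambda),B(\lambda)):\lambda\in M_n\}$, and $M_n^{(a,b)}:=\{\lambda\in M_n:(A(\lambda),B(\lambda))=(a,b)\}$. *)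

theory Defs
  imports "HOL-Library.Multiset"
begin

definition triangular :: "nat \<Rightarrow> nat" where
  "triangular m = m * (m + 1) div 2"

definition partitions :: "nat \<Rightarrow> nat multiset set" where
  "partitions n = {p. 0 \<notin># p \<and> sum_mset p = n}"

definition parts_list :: "nat multiset \<Rightarrow> nat list" where
  "parts_list p = rev (sorted_list_of_multiset p)"

text \<open>The compressed form of \<open>p\<close> is given by the distinct part sizes
  \<open>L\<^sub>1 > \<dots> > L\<^sub>r > 0\<close>, listed by \<open>part_sizes p\<close> with indices shifted to start at \<open>0\<close>, and
  the multiplicities \<open>count p L\<^sub>i\<close>.\<close>

definition part_sizes :: "nat multiset \<Rightarrow> nat list" where
  "part_sizes p = rev (sorted_list_of_set (set_mset p))"

definition gap :: "nat multiset \<Rightarrow> nat \<Rightarrow> nat" where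
  "gap p i = (let L = part_sizes p in
     if Suc i < length L then L ! i - L ! Suc i else L ! i)"

definition A_stat :: "nat multiset \<Rightarrow> nat" where
  "A_stat p = card {i. i < length (part_sizes p) \<and> gap p i > 1}"

definition B_stat :: "nat multiset \<Rightarrow> nat" where
  "B_stat p = card {i. i < length (part_sizes p) \<and> count p (part_sizes p ! i) > 1}"

text \<open>Cells are pairs (row, column), both counted from \<open>0\<close>; the transpose of a diagram is the
  converse relation.\<close>

definition ferrers :: "nat multiset \<Rightarrow> (nat \<times> nat) set" where
  "ferrers p = {(i, j). i < size p \<and> j < parts_list p ! i}"

definition conjugate :: "nat multiset \<Rightarrow> nat multiset" where
  "conjugate p = (THE r. 0 \<notin># r \<and> ferrers r = (ferrers p)\<inverse>)"

text \<open>One unit moves from a part \<open>x\<close> to another part \<open>y\<close>. Adding a single zero part to \<open>p\<close> makes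
  it available as a receiving part, and \<open>{#x, y#} \<subseteq># _\<close> forces \<open>x\<close> and \<open>y\<close> to be different
  occurrences (though they may have the same value).\<close>

definition transfer :: "nat multiset \<Rightarrow> nat multiset \<Rightarrow> bool" where
  "transfer p r \<longleftrightarrow> (\<exists>x y. x > 0 \<and> {#x, y#} \<subseteq># add_mset 0 p \<and>
     r = filter_mset (\<lambda>k. k > 0) (add_mset 0 p - {#x, y#} + {#x - 1, y + 1#}))"

definition adjacent :: "nat multiset \<Rightarrow> nat multiset \<Rightarrow> bool" where
  "adjacent p r \<longleftrightarrow> p \<noteq> r \<and> (transfer p r \<or> transfer r p)"

definition deg :: "nat \<Rightarrow> nat multiset \<Rightarrow> nat" where
  "deg n p = card {r \<in> partitions n. adjacent p r}"

definition max_deg :: "nat \<Rightarrow> nat" where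
  "max_deg n = Max (deg n ` partitions n)"

definition M_set :: "nat \<Rightarrow> nat multiset set" where
  "M_set n = {p \<in> partitions n. deg n p = max_deg n}"

definition Pi_set :: "nat \<Rightarrow> (nat \<times> nat) set" where
  "Pi_set n = (\<lambda>p. (A_stat p, B_stat p)) ` M_set n"

definition M_type :: "nat \<Rightarrow> nat \<times> nat \<Rightarrow> nat multiset set" where
  "M_type n ab = {p \<in> M_set n. (A_stat p, B_stat p) = ab}"

lemma length_parts_list [simp]: "length (parts_list p) = size p"
  unfolding parts_list_def by (metis length_rev mset_sorted_list_of_multiset size_mset)

lemma mset_parts_list [simp]: "mset (parts_list p) = p"
  by (simp add: parts_list_def)

lemma parts_list_antimono:
  "i \<le> j \<Longrightarrow> j < size p \<Longrightarrow> parts_list p ! j \<le> parts_list p ! i"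
  using sorted_sorted_list_of_multiset[of p] length_parts_list[of p]
  unfolding parts_list_def
  by (metis rev_rev_ident sorted_rev_nth_mono)

lemma parts_list_eqI:
  assumes "mset xs = p" and "sorted (rev xs)"
  shows "parts_list p = xs"
proof -
  have "sorted_list_of_multiset p = sort (rev xs)"
    using assms(1) by (metis mset_rev sorted_list_of_multiset_mset)
  also have "\<dots> = rev xs" using assms(2) by (simp add: sorted_sort_id)
  finally show ?thesis by (simp add: parts_list_def)
qed

lemma parts_list_pos:
  assumes "0 \<notin># p" "i < size p"
  shows "0 < parts_list p ! i"
  using assms by (metis gr0I length_parts_list mset_parts_list nth_mem_mset)

lemma ferrers_inject:
  assumes p: "0 \<notin># p" and r: "0 \<notin># r" and eq: "ferrers p = ferrers r"
  shows "p = r"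
proof -
  have sz: "{i. (i, 0) \<in> ferrers u} = {..<size u}" if "0 \<notin># u" for u
    using parts_list_pos[OF that] by (auto simp: ferrers_def)
  have size: "size p = size r"
    using sz[OF p] sz[OF r] eq by (metis card_lessThan)
  have row: "{j. (i, j) \<in> ferrers u} = {..<parts_list u ! i}" if "i < size u" for i u
    using that by (auto simp: ferrers_def)
  have "parts_list p = parts_list r"
  proof (rule nth_equalityI)
    fix i assume "i < length (parts_list p)"
    then show "parts_list p ! i = parts_list r ! i"
      using row[of i p] row[of i r] eq size by (metis card_lessThan length_parts_list)
  qed (simp add: size)
  then show ?thesis by (metis mset_parts_list)
qed

lemma conjugate_ex1: "\<exists>!r. 0 \<notin># r \<and> ferrers r = (ferrers p)\<inverse>"
proof -
  define c where "c j = card {i. (i, j) \<in> ferrers p}" for j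
  have col: "{i. (i, j) \<in> ferrers p} = {..<c j}" for j
  proof -
    let ?S = "{i. (i, j) \<in> ferrers p}"
    have fin: "finite ?S" by (rule finite_subset[of _ "{..<size p}"]) (auto simp: ferrers_def)
    have down: "k \<in> ?S" if "i \<in> ?S" "k \<le> i" for i k
      using that parts_list_antimono[of k i p] by (auto simp: ferrers_def)
    have "\<exists>m. ?S = {..<m}"
    proof (cases "?S = {}")
      case True then show ?thesis by (intro exI[of _ 0]) auto
    next
      case False
      then have "Max ?S \<in> ?S" using fin by (rule Max_in[rotated])
      then have "?S = {..<Suc (Max ?S)}"
        by (intro set_eqI) (metis down Max_ge[OF fin] less_Suc_eq_le lessThan_iff)
      then show ?thesis by blast
    qed
    then show ?thesis unfolding c_def by (metis card_lessThan)
  qed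
  have iff: "i < c j \<longleftrightarrow> (i, j) \<in> ferrers p" for i j using col[of j] by blast
  define w where "w = (if size p = 0 then 0 else parts_list p ! 0)"
  have w: "j < w" if "(i, j) \<in> ferrers p" for i j
    using that parts_list_antimono[of 0 i p] by (auto simp: ferrers_def w_def)
  have w0: "(0, j) \<in> ferrers p" if "j < w" for j
    using that by (auto simp: ferrers_def w_def nonempty_has_size split: if_splits)
  define xs where "xs = map c [0..<w]"
  have anti: "c j \<le> c i" if "i \<le> j" for i j
  proof (rule ccontr)
    assume "\<not> c j \<le> c i"
    then have "c i < c j" by simp
    then have "(c i, j) \<in> ferrers p" using iff by blast
    then have "(c i, i) \<in> ferrers p" using that by (auto simp: ferrers_def)
    then show False using iff by blast
  qed
  have "sorted (rev xs)"
    by (auto simp: sorted_rev_iff_nth_mono xs_def intro: anti)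
  then have pl: "parts_list (mset xs) = xs" by (simp add: parts_list_eqI)
  have "ferrers (mset xs) = (ferrers p)\<inverse>"
  proof -
    have "(i, j) \<in> ferrers (mset xs) \<longleftrightarrow> i < w \<and> j < c i" for i j
      unfolding ferrers_def pl by (auto simp: xs_def)
    then show ?thesis using w iff by auto
  qed
  moreover have "0 \<notin># mset xs"
  proof -
    have "0 < c j" if "j < w" for j using w0[OF that] iff by blast
    then have "0 \<notin> c ` {0..<w}" by force
    then show ?thesis by (simp add: xs_def)
  qed
  ultimately show ?thesis using ferrers_inject by metis
qed

lemma conjugate: "0 \<notin># conjugate p" "ferrers (conjugate p) = (ferrers p)\<inverse>"
  using theI'[OF conjugate_ex1[of p]] by (auto simp: conjugate_def)

lemma finite_partitions: "finite (partitions n)"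
proof -
  have "size p \<le> n \<and> set_mset p \<subseteq> {..n}" if "p \<in> partitions n" for p
  proof -
    have "0 \<notin># q \<Longrightarrow> size q \<le> sum_mset q" for q :: "nat multiset"
      by (induction q) auto
    moreover have "x \<le> n" if "x \<in># p" for x
      using sum_mset.remove[OF that] \<open>p \<in> partitions n\<close> by (auto simp: partitions_def)
    ultimately show ?thesis
      using that by (auto simp: partitions_def)
  qed
  then have "parts_list p \<in> {xs. set xs \<subseteq> {..n} \<and> length xs \<le> n}" if "p \<in> partitions n" for p
    using that by (simp flip: set_mset_mset)
  then have "partitions n \<subseteq> mset ` {xs. set xs \<subseteq> {..n} \<and> length xs \<le> n}"
    using mset_parts_list by (force simp del: mem_Collect_eq intro: rev_image_eqI)
  then show ?thesis by (rule finite_subset) (simp add: finite_lists_length_le)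
qed

lemma partitions_nonempty: "partitions n \<noteq> {}"
  by (auto simp: partitions_def intro!: exI[of _ "replicate_mset n 1"] split: if_splits)

end

(* Moving one unit between parts is the same as moving one cell of the Ferrers diagram, a relation
   that does not distinguish rows from columns. Hence conjugation is an automorphism of the
   partition graph and preserves degrees. The statistics A and B both count corner cells of the
   diagram, subject to two conditions that are exchanged by transposition. *)
theory Submission
  imports Defs
begin

section \<open>Columns of the Ferrers diagram\<close>

text \<open>Column heights, that is, the parts of the conjugate padded with zeros. They need no
  sorting and are additive in the multiset, so a transfer becomes arithmetic on them.\<close>

definition column :: "nat multiset \<Rightarrow> nat \<Rightarrow> nat" where
  "column p j = size {#x \<in># p. j < x#}"

lemma column_empty [simp]: "column {#} j = 0"
  by (simp add: column_def)

lemma column_add_mset [simp]: "column (add_mset x p) j = (if j < x then 1 else 0) + column p j"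
  by (simp add: column_def)

lemma column_union [simp]: "column (p + r) j = column p j + column r j"
  by (simp add: column_def)

text \<open>Zero parts fill no cell, so the auxiliary zero part in \<open>transfer\<close> and the
  discarding of zeros leave column heights unchanged.\<close>

lemma column_filter_pos [simp]: "column {#x \<in># p. 0 < x#} j = column p j"
  by (induction p) auto

lemma column_Suc: "column p j = column p (Suc j) + count p (Suc j)"
  by (induction p) auto

lemma column_antimono: "i \<le> j \<Longrightarrow> column p j \<le> column p i"
  by (induction p) auto

text \<open>Rows are listed in weakly decreasing order, so those longer than \<open>j\<close> form
  an initial segment, determined by its size.\<close>

lemma mem_ferrers_iff: "(i, j) \<in> ferrers p \<longleftrightarrow> i < column p j"
proof -
  let ?S = "{i. i < size p \<and> j < parts_list p ! i}"
  have fin: "finite ?S" by simp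
  have down: "k \<in> ?S" if "i \<in> ?S" "k \<le> i" for i k
    using that parts_list_antimono[of k i p] by auto
  have "\<exists>m. ?S = {..<m}"
  proof (cases "?S = {}")
    case True
    then show ?thesis by (intro exI[of _ 0]) auto
  next
    case False
    then have "Max ?S \<in> ?S" using fin by (rule Max_in[rotated])
    then have "?S = {..<Suc (Max ?S)}"
      by (intro set_eqI) (metis (no_types, lifting) down Max_ge[OF fin] less_Suc_eq_le lessThan_iff)
    then show ?thesis by blast
  qed
  then obtain m where m: "?S = {..<m}" by blast
  have "column p j = length (filter (\<lambda>x. j < x) (parts_list p))"
    unfolding column_def by (metis mset_filter mset_parts_list size_mset)
  also have "\<dots> = m"
    using m by (simp add: length_filter_conv_card)
  finally show ?thesis
    using m by (auto simp: ferrers_def)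
qed

lemma column_inject: "0 \<notin># p \<Longrightarrow> 0 \<notin># r \<Longrightarrow> (\<And>j. column p j = column r j) \<Longrightarrow> p = r"
  by (rule ferrers_inject) (auto simp: mem_ferrers_iff)

lemma card_ferrers: "card (ferrers p) = sum_mset p"
proof -
  have "ferrers p = (SIGMA i:{..<size p}. {..<parts_list p ! i})"
    by (auto simp: ferrers_def)
  then have "card (ferrers p) = (\<Sum>i<size p. parts_list p ! i)"
    by simp
  also have "\<dots> = sum_list (parts_list p)"
    by (simp add: sum_list_sum_nth atLeast0LessThan)
  also have "\<dots> = sum_mset p"
    by (metis mset_parts_list sum_mset_sum_list)
  finally show ?thesis .
qed

section \<open>Conjugation\<close>

lemma conjugate_conjugate: "0 \<notin># p \<Longrightarrow> conjugate (conjugate p) = p"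
  by (rule ferrers_inject) (simp_all add: conjugate)

lemma conjugate_in_partitions: "p \<in> partitions n \<Longrightarrow> conjugate p \<in> partitions n"
  by (simp add: partitions_def conjugate flip: card_ferrers)

lemma bij_betw_conjugate_partitions: "bij_betw conjugate (partitions n) (partitions n)"
  by (rule bij_betw_byWitness[where f' = conjugate])
    (auto simp: conjugate_in_partitions, auto simp: partitions_def conjugate_conjugate)

section \<open>Adjacency\<close>

text \<open>\<open>G\<close> need not be a diagram here; where that matters, it is given as some
  \<open>ferrers r\<close>.\<close>

definition cell_move :: "('a \<times> 'a) set \<Rightarrow> ('a \<times> 'a) set \<Rightarrow> bool" where
  "cell_move F G \<longleftrightarrow> (\<exists>u\<in>F. \<exists>v. v \<notin> F \<and> G = insert v (F - {u}))"

lemma cell_move_converse: "cell_move F G \<Longrightarrow> cell_move (F\<inverse>) (G\<inverse>)"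
proof -
  assume "cell_move F G"
  then obtain i a k b where "(i, a) \<in> F" "(k, b) \<notin> F" "G = insert (k, b) (F - {(i, a)})"
    by (auto simp: cell_move_def)
  then show ?thesis
    unfolding cell_move_def by (intro bexI[of _ "(a, i)"] exI[of _ "(b, k)"]) auto
qed

text \<open>Lowering \<open>x\<close> shortens column \<open>x - 1\<close> by one cell and raising
  \<open>y\<close> lengthens column \<open>y\<close> by one, so the bottom cell of one column moves
  to the bottom of another.\<close>

lemma transfer_imp_cell_move:
  assumes p: "0 \<notin># p" and "p \<noteq> r" and "transfer p r"
  shows "cell_move (ferrers p) (ferrers r)"
proof -
  obtain x y where x: "x > 0" and sub: "{#x, y#} \<subseteq># add_mset 0 p"
    and r: "r = {#k \<in># add_mset 0 p - {#x, y#} + {#x - 1, y + 1#}. 0 < k#}"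
    using \<open>transfer p r\<close> unfolding transfer_def by blast
  define t where "t = add_mset 0 p - {#x, y#}"
  have t: "add_mset 0 p = t + {#x, y#}"
    using subset_mset.diff_add[OF sub] by (simp only: t_def)
  have r': "r = {#k \<in># t + {#x - 1, y + 1#}. 0 < k#}"
    using r by (simp add: t_def)
  \<comment> \<open>Otherwise the two parts merely exchange their values and
    \<open>r = p\<close>.\<close>
  have "y \<noteq> x - 1"
  proof
    assume "y = x - 1"
    then have "t + {#x - 1, y + 1#} = add_mset 0 p"
      using x t by (simp add: add_mset_commute)
    moreover have "{#k \<in># p. 0 < k#} = p"
      using p by (metis filter_mset_cong filter_mset_True gr0I)
    ultimately show False
      using r' \<open>p \<noteq> r\<close> by simp
  qed
  have cp: "column p j = column t j + (if j < x then 1 else 0) + (if j < y then 1 else 0)" for j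
    using arg_cong[OF t, of "\<lambda>u. column u j"] by simp
  have cr: "column r j = column t j + (if j < x - 1 then 1 else 0) + (if j < y + 1 then 1 else 0)"
    for j
    unfolding r' column_filter_pos by simp
  have cr_cp: "column r j =
      (if j = x - 1 then column p j - 1 else if j = y then column p j + 1 else column p j)" for j
    using x \<open>y \<noteq> x - 1\<close> cp[of j] cr[of j] by auto
  have pos: "column p (x - 1) > 0"
    using cp[of "x - 1"] x by simp
  show ?thesis
    unfolding cell_move_def
  proof (intro bexI exI conjI)
    show "(column p (x - 1) - 1, x - 1) \<in> ferrers p" "(column p y, y) \<notin> ferrers p"
      using pos by (auto simp: mem_ferrers_iff)
    show "ferrers r = insert (column p y, y) (ferrers p - {(column p (x - 1) - 1, x - 1)})"
      using \<open>y \<noteq> x - 1\<close> by (auto simp: set_eq_iff mem_ferrers_iff cr_cp)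
  qed
qed

text \<open>If the cell leaves column \<open>a\<close> and enters column \<open>b\<close>, a part
  \<open>a + 1\<close> drops to \<open>a\<close> and a part \<open>b\<close> rises to
  \<open>b + 1\<close>. Such parts exist because the column heights of \<open>r\<close> are weakly
  decreasing.\<close>

lemma cell_move_imp_transfer:
  assumes p: "0 \<notin># p" and r: "0 \<notin># r" and "p \<noteq> r" and "cell_move (ferrers p) (ferrers r)"
  shows "transfer p r"
proof -
  obtain i a k b where ia: "(i, a) \<in> ferrers p" and kb: "(k, b) \<notin> ferrers p"
    and F: "ferrers r = insert (k, b) (ferrers p - {(i, a)})"
    using assms(4) by (auto simp: cell_move_def)
  have set: "{..<column r j} =
      (if j = b then insert k else id) ({..<column p j} - (if j = a then {i} else {}))" for j
    using F by (auto simp: set_eq_iff mem_ferrers_iff split: if_splits)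
  \<comment> \<open>Comparing cardinalities avoids locating the moved cell inside its
    column.\<close>
  have card: "column r j = card
      ((if j = b then insert k else id) ({..<column p j} - (if j = a then {i} else {})))" for j
    by (metis card_lessThan set)
  have i: "i < column p a" and k: "\<not> k < column p b"
    using ia kb by (auto simp: mem_ferrers_iff)
  have "a \<noteq> b"
  proof
    assume "a = b"
    then have "column r j = column p j" for j
      using card[of j] i k by (auto simp: card_insert_if card_Diff_singleton)
    then show False
      using column_inject[OF p r] \<open>p \<noteq> r\<close> by simp
  qed
  have cr: "column r j =
      (if j = a then column p j - 1 else if j = b then column p j + 1 else column p j)" for j
    using card[of j] i k \<open>a \<noteq> b\<close> by (auto simp: card_insert_if card_Diff_singleton)
  \<comment> \<open>Column \<open>a\<close> loses a cell and still is at least as high as column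
    \<open>a + 1\<close> in \<open>r\<close>, so the former was strictly higher in
    \<open>p\<close>.\<close>
  have a: "Suc a \<in># p"
    using column_antimono[of a "Suc a" r] i column_Suc[of p a]
    by (auto simp: cr simp flip: count_greater_zero_iff split: if_splits)
  \<comment> \<open>For \<open>b = 0\<close> the receiver is the added zero part; otherwise column
    \<open>b\<close> can only grow if column \<open>b - 1\<close> was strictly higher in
    \<open>p\<close>.\<close>
  have b: "b \<in># add_mset 0 p"
  proof (cases b)
    case (Suc m)
    then show ?thesis
      using column_antimono[of m b r] column_Suc[of p m] \<open>a \<noteq> b\<close>
      by (auto simp: cr simp flip: count_greater_zero_iff split: if_splits)
  qed simp
  \<comment> \<open>Here giver and receiver have the same size, so two occurrences are needed: the
    height difference of columns \<open>a\<close> and \<open>b\<close> shrinks by 2.\<close>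
  have ab: "count p b \<ge> 2" if "b = Suc a"
    using column_antimono[of a b r] column_Suc[of p a] that i by (auto simp: cr)
  have sub: "{#Suc a, b#} \<subseteq># add_mset 0 p"
    using a b ab by (auto simp: subseteq_mset_def Suc_le_eq)
  define t where "t = add_mset 0 p - {#Suc a, b#}"
  have t: "add_mset 0 p = t + {#Suc a, b#}"
    using subset_mset.diff_add[OF sub] by (simp only: t_def)
  have cp: "column p j = column t j + (if j < Suc a then 1 else 0) + (if j < b then 1 else 0)" for j
    using arg_cong[OF t, of "\<lambda>u. column u j"] by simp
  have "r = {#k \<in># t + {#Suc a - 1, b + 1#}. 0 < k#}"
  proof (rule column_inject[OF r])
    show "column r j = column {#k \<in># t + {#Suc a - 1, b + 1#}. 0 < k#} j" for j
      unfolding column_filter_pos using cp[of j] cr[of j] \<open>a \<noteq> b\<close> by auto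
  qed simp
  then show ?thesis
    unfolding transfer_def t_def using sub by blast
qed

lemma adjacent_iff_cell_move:
  assumes "0 \<notin># p" and "0 \<notin># r"
  shows "adjacent p r \<longleftrightarrow>
    p \<noteq> r \<and> (cell_move (ferrers p) (ferrers r) \<or> cell_move (ferrers r) (ferrers p))"
  using assms transfer_imp_cell_move cell_move_imp_transfer unfolding adjacent_def by metis

lemma adjacent_conjugate:
  assumes "0 \<notin># p" and "0 \<notin># r" and "adjacent p r"
  shows "adjacent (conjugate p) (conjugate r)"
  using assms cell_move_converse conjugate_conjugate
  by (metis adjacent_iff_cell_move conjugate)

lemma adjacent_conjugate_iff:
  assumes "0 \<notin># p" and "0 \<notin># r"
  shows "adjacent (conjugate p) (conjugate r) \<longleftrightarrow> adjacent p r"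
  using assms adjacent_conjugate conjugate(1) conjugate_conjugate by metis

lemma deg_conjugate:
  assumes "0 \<notin># p"
  shows "deg n (conjugate p) = deg n p"
proof -
  have "bij_betw conjugate {r \<in> partitions n. adjacent p r}
      {r \<in> partitions n. adjacent (conjugate p) r}"
    by (rule bij_betw_Collect[OF bij_betw_conjugate_partitions])
      (use assms in \<open>auto simp: partitions_def adjacent_conjugate_iff\<close>)
  then show ?thesis
    by (simp add: deg_def bij_betw_same_card)
qed

section \<open>Corner cells\<close>

definition corners :: "(nat \<times> nat) set \<Rightarrow> (nat \<times> nat) set" where
  "corners F = {(i, j). (i, j) \<in> F \<and> (Suc i, j) \<notin> F \<and> (i, Suc j) \<notin> F}"

lemma corners_converse: "(i, j) \<in> corners (F\<inverse>) \<longleftrightarrow> (j, i) \<in> corners F"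
  by (auto simp: corners_def)

text \<open>The drop from column \<open>j\<close> to column \<open>j + 1\<close> is the multiplicity
  of \<open>j + 1\<close>, so corners correspond to distinct part sizes.\<close>

lemma mem_corners_iff:
  "(i, j) \<in> corners (ferrers p) \<longleftrightarrow> Suc i = column p j \<and> Suc j \<in># p"
  using column_Suc[of p j]
  by (auto simp: corners_def mem_ferrers_iff simp flip: count_greater_zero_iff)

lemma card_part_sizes:
  "card {i. i < length (part_sizes p) \<and> P (part_sizes p ! i)} = card {x \<in> set_mset p. P x}"
proof -
  have "distinct (part_sizes p)" and set: "set (part_sizes p) = set_mset p"
    by (simp_all add: part_sizes_def)
  then have inj: "inj_on ((!) (part_sizes p)) {i. i < length (part_sizes p) \<and> P (part_sizes p ! i)}"
    by (auto simp: inj_on_def nth_eq_iff_index_eq)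
  have "(!) (part_sizes p) ` {i. i < length (part_sizes p) \<and> P (part_sizes p ! i)}
      = {x \<in> set_mset p. P x}"
    unfolding set[symmetric] by (auto simp: in_set_conv_nth)
  then show ?thesis
    using card_image[OF inj] by simp
qed

text \<open>Sizes strictly decrease, so a gap is 1 exactly when the size minus one is the next size.
  For the smallest size the gap is the size itself, which the condition \<open>> 1\<close>
  covers.\<close>

lemma gap_gt_1_iff:
  assumes p: "0 \<notin># p" and i: "i < length (part_sizes p)"
  shows "gap p i > 1 \<longleftrightarrow> part_sizes p ! i > 1 \<and> part_sizes p ! i - 1 \<notin># p"
proof -
  let ?L = "part_sizes p"
  have set: "set ?L = set_mset p"
    by (simp add: part_sizes_def)
  have pos: "0 < ?L ! k" if "k < length ?L" for k
    using p nth_mem[OF that] unfolding set by (metis gr0I)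
  have "sorted_wrt (>) ?L"
    by (simp add: part_sizes_def sorted_wrt_rev)
  then have less: "?L ! l < ?L ! k" if "k < l" "l < length ?L" for k l
    using that by (simp add: sorted_wrt_iff_nth_less)
  show ?thesis
  proof (cases "Suc i < length ?L")
    case True
    have "?L ! i - 1 \<in># p \<longleftrightarrow> ?L ! i - 1 = ?L ! Suc i"
    proof
      assume "?L ! i - 1 \<in># p"
      then obtain k where k: "k < length ?L" "?L ! k = ?L ! i - 1"
        using set by (metis in_set_conv_nth)
      have "i < k"
        using k less[of k i] pos[OF i] i by (cases i k rule: linorder_cases) auto
      then have "?L ! k \<le> ?L ! Suc i"
        using less[of "Suc i" k] k by (cases "k = Suc i") auto
      then show "?L ! i - 1 = ?L ! Suc i"
        using k less[of i "Suc i"] True by simp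
    next
      assume "?L ! i - 1 = ?L ! Suc i"
      then show "?L ! i - 1 \<in># p"
        using set True by (metis nth_mem)
    qed
    then show ?thesis
      using True less[of i "Suc i"] pos[OF True] by (auto simp: gap_def Let_def)
  next
    case False
    have "?L ! i - 1 \<notin># p"
    proof
      assume "?L ! i - 1 \<in># p"
      then obtain k where k: "k < length ?L" "?L ! k = ?L ! i - 1"
        using set by (metis in_set_conv_nth)
      then have "k < i \<or> k = i"
        using False by auto
      then show False
        using k less[of k i] pos[OF i] i by auto
    qed
    then show ?thesis
      using False by (simp add: gap_def Let_def)
  qed
qed

(* A corner (i, j) is the last cell of the lowest row of length j + 1. That length occurs more than
   once iff row i - 1 does not reach column j + 1; row i + 1, if it exists, has length less than j
   iff it does not reach column j - 1. *)
lemma B_stat_eq_card_corners: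
  "B_stat p =
    card {(i, j). (i, j) \<in> corners (ferrers p) \<and> 0 < i \<and> (i - 1, Suc j) \<notin> ferrers p}"
  if p: "0 \<notin># p"
proof -
  have "B_stat p = card {x \<in> set_mset p. count p x > 1}"
    unfolding B_stat_def by (rule card_part_sizes)
  \<comment> \<open>Each size \<open>x\<close> is sent to its corner; the column index
    \<open>x - 1\<close> recovers \<open>x\<close> because parts are positive.\<close>
  also have "\<dots> = card ((\<lambda>x. (column p (x - 1) - 1, x - 1)) ` {x \<in> set_mset p. count p x > 1})"
    using p by (intro card_image[symmetric]) (auto simp: inj_on_def, metis gr0I Suc_pred)
  also have "(\<lambda>x. (column p (x - 1) - 1, x - 1)) ` {x \<in> set_mset p. count p x > 1} =
      {(i, j). (i, j) \<in> corners (ferrers p) \<and> 0 < i \<and> (i - 1, Suc j) \<notin> ferrers p}"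
    (is "?f ` ?X = ?Y")
  proof (intro equalityI subsetI)
    fix c assume "c \<in> ?f ` ?X"
    then obtain x where x: "x \<in># p" "count p x > 1" "c = ?f x" by auto
    moreover from this p obtain j where "x = Suc j" by (cases x) auto
    ultimately show "c \<in> ?Y"
      using column_Suc[of p j] by (auto simp: mem_corners_iff mem_ferrers_iff)
  next
    fix c assume "c \<in> ?Y"
    then obtain i j where c: "c = (i, j)" "Suc i = column p j" "Suc j \<in># p" "0 < i"
      "\<not> i - 1 < column p (Suc j)"
      by (auto simp: mem_corners_iff mem_ferrers_iff)
    then show "c \<in> ?f ` ?X"
      using column_Suc[of p j] by (intro image_eqI[of _ _ "Suc j"]) auto
  qed
  finally show ?thesis .
qed

lemma A_stat_eq_card_corners:
  "A_stat p =
    card {(i, j). (i, j) \<in> corners (ferrers p) \<and> 0 < j \<and> (Suc i, j - 1) \<notin> ferrers p}"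
  if p: "0 \<notin># p"
proof -
  have "A_stat p = card {i. i < length (part_sizes p) \<and>
      (part_sizes p ! i > 1 \<and> part_sizes p ! i - 1 \<notin># p)}"
    unfolding A_stat_def
    by (intro arg_cong[where f = card] Collect_cong conj_cong refl gap_gt_1_iff[OF p])
  also have "\<dots> = card {x \<in> set_mset p. x > 1 \<and> x - 1 \<notin># p}"
    by (rule card_part_sizes)
  also have "\<dots> =
      card ((\<lambda>x. (column p (x - 1) - 1, x - 1)) ` {x \<in> set_mset p. x > 1 \<and> x - 1 \<notin># p})"
    by (intro card_image[symmetric]) (auto simp: inj_on_def)
  also have "(\<lambda>x. (column p (x - 1) - 1, x - 1)) ` {x \<in> set_mset p. x > 1 \<and> x - 1 \<notin># p} =
      {(i, j). (i, j) \<in> corners (ferrers p) \<and> 0 < j \<and> (Suc i, j - 1) \<notin> ferrers p}"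
    (is "?f ` ?X = ?Y")
  proof (intro equalityI subsetI)
    fix c assume "c \<in> ?f ` ?X"
    then obtain x where x: "x \<in># p" "x > 1" "x - 1 \<notin># p" "c = ?f x" by auto
    moreover from this obtain m where "x = Suc (Suc m)"
      by (metis One_nat_def less_imp_Suc_add add_Suc)
    ultimately show "c \<in> ?Y"
      using column_Suc[of p m] column_Suc[of p "Suc m"]
      by (auto simp: mem_corners_iff mem_ferrers_iff not_in_iff)
  next
    fix c assume "c \<in> ?Y"
    then obtain i j where c: "c = (i, j)" "Suc i = column p j" "Suc j \<in># p" "0 < j"
      "\<not> Suc i < column p (j - 1)"
      by (auto simp: mem_corners_iff mem_ferrers_iff)
    \<comment> \<open>Columns \<open>j - 1\<close> and \<open>j\<close> are equally high, so no part
      equals \<open>j\<close>.\<close>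
    then have "j \<notin># p"
      using column_Suc[of p "j - 1"] by (auto simp: not_in_iff)
    with c show "c \<in> ?f ` ?X"
      by (intro image_eqI[of _ _ "Suc j"]) auto
  qed
  finally show ?thesis .
qed

text \<open>Transposition maps corners to corners and turns the side condition counted by A into the
  one counted by B.\<close>

lemma A_stat_conjugate:
  assumes "0 \<notin># p"
  shows "A_stat (conjugate p) = B_stat p"
proof -
  have "{(i, j). (i, j) \<in> corners ((ferrers p)\<inverse>) \<and> 0 < j \<and> (Suc i, j - 1) \<notin> (ferrers p)\<inverse>} =
      {(i, j). (i, j) \<in> corners (ferrers p) \<and> 0 < i \<and> (i - 1, Suc j) \<notin> ferrers p}\<inverse>"
    by (auto simp: corners_converse)
  then show ?thesis
    using assms by (simp add: A_stat_eq_card_corners B_stat_eq_card_corners conjugate)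
qed

lemma B_stat_conjugate: "0 \<notin># p \<Longrightarrow> B_stat (conjugate p) = A_stat p"
  using A_stat_conjugate[OF conjugate(1)] by (metis conjugate_conjugate)

text \<open>The degree stays maximal, since \<open>max_deg n\<close> depends only on
  \<open>n\<close>, while the two statistics swap.\<close>

lemma conjugate_in_M_type: "p \<in> M_type n (a, b) \<Longrightarrow> conjugate p \<in> M_type n (b, a)"
  using conjugate_in_partitions[of p n]
  by (auto simp: M_type_def M_set_def partitions_def deg_conjugate A_stat_conjugate
      B_stat_conjugate)

lemma bij_betw_conjugate_M_type: "bij_betw conjugate (M_type n (a, b)) (M_type n (b, a))"
proof (rule bij_betw_byWitness[where f' = conjugate])
  show "\<forall>p\<in>M_type n (a, b). conjugate (conjugate p) = p"
    "\<forall>p\<in>M_type n (b, a). conjugate (conjugate p) = p"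
    by (auto simp: M_type_def M_set_def partitions_def conjugate_conjugate)
qed (auto simp: conjugate_in_M_type)

theorem corollary6p6:
  fixes s q n :: nat
  assumes "s \<ge> 1" and "q \<le> s" and "n = triangular s + q"
  shows "\<forall>(a, b) \<in> Pi_set n.
    bij_betw conjugate (M_type n (a, b)) (M_type n (b, a)) \<and>
    card (M_type n (a, b)) = card (M_type n (b, a))"
  using bij_betw_conjugate_M_type bij_betw_same_card by blast

end
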